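(* Let $\mathcal{A}=\mathbb{ISP}(\mathfrak{M})$, where $\mathfrak{M}$ is a finite set of finite $\mathcal{D}$-based algebras of common type, and for each $\mathbf{M}\in\mathfrak{M}$ let $\Omega_{\mathbf{M}}\subseteq\mathcal{D}(U(\mathbf{M}),\mathbf{2})$ be a (possibly empty) subset such that, with $\Omega=\bigcup_{\mathbf{M}\in\mathfrak{M}}\Omega_{\mathbf{M}}$, the condition $(\mathrm{Sep})_{\mathfrak{M},\Omega}$ holds. For each $\mathbf{A}\in\mathcal{A}$, the structure $(Y,\preccurlyeq,\mathscr{T}^Y)$ associated with $\mathbf{A}$ (defined in the context) has the following properties. (i) The space $(Y,\mathscr{T}^Y)$ is compact and Hausdorff. (ii) The binary relation $\preccurlyeq\;\subseteq Y^2$ is a pre-order on $Y$. (iii) Let $\approx\;=\;\preccurlyeq\cap\succcurlyeq$ be the equivalence relation on $Y$ determined by $\preccurlyeq$. Then $(Y/{\approx},\ {\preccurlyeq}/{\approx},\ \mathscr{T}^Y/{\approx})$ is a Priestley space isomorphic to $HU(\mathbf{A})$, where $\mathscr{T}^Y/{\approx}$ denotes the quotient topology.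
   Context: $\mathcal{D}$ is the category of bounded distributive lattices with lattice homomorphisms preserving $0$ and $1$; $\mathbf{2}$ is the two-element member. A $\mathcal{D}$-based algebra $\mathbf{A}$ is one whose language contains (up to term-equivalence) $\wedge,\vee,0,1$ so that the reduct $U(\mathbf{A})=(A,\wedge,\vee,0,1)$ is in $\mathcal{D}$; $U\colon\mathcal{A}\to\mathcal{D}$ is the resulting forgetful functor, identical on maps. $\mathcal{A}(\cdot,\cdot)$, $\mathcal{D}(\cdot,\cdot)$ denote hom-sets; $\mathbb{ISP}(\mathfrak{M})$ is the class of isomorphic copies of subalgebras of products of members of $\mathfrak{M}$. $H(\mathbf{L})=\mathcal{D}(\mathbf{L},\mathbf{2})$, with pointwise order and topology inherited from the power $\{0,1\}^L$ of the discrete space, is the Priestley dual space of $\mathbf{L}\in\mathcal{D}$. $(\mathrm{Sep})_{\mathfrak{M},\Omega}$: for all $\mathbf{M}\in\mathfrak{M}$ and $a\neq b$ in $\mathbf{M}$ there exist $\mathbf{M}'\in\mathfrak{M}$, $u\in\mathcal{A}(\mathbf{M},\mathbf{M}')$ and $\omega\in\Omega_{\mathbf{M}'}$ with $\omega(u(a))\neq\omega(u(b))$. For $\omega_i\in\Omega_{\mathbf{M}_i}$ ($i=1,2$), $R_{\omega_1,\omega_2}$ is the set of subalgebras of $\mathbf{M}_1\times\mathbf{M}_2$ which are maximal among the subalgebras contained in $(\omega_1,\omega_2)^{-1}(\leqslant)=\{(a,b)\in\mathbf{M}_1\times\mathbf{M}_2\mid\omega_1(a)\leq\omega_2(b)\}$.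 For fixed $\mathbf{A}\in\mathcal{A}$, let $X_{\mathbf{M}}=\mathcal{A}(\mathbf{A},\mathbf{M})$ for $\mathbf{M}\in\mathfrak{M}$, with the topology inherited from the power $M^A$ of the discrete space $M$. For $r\in R_{\omega_1,\omega_2}$, $x\in X_{\mathbf{M}_1}$ and $y\in X_{\mathbf{M}_2}$, write $(x,y)\in r^{\mathbf{X}}$ if $(x(a),y(a))\in r$ for all $a\in A$. Let $Y=\bigcup\{X_{\mathbf{M}}\times\Omega_{\mathbf{M}}\mid\mathbf{M}\in\mathfrak{M}\}$ (a disjoint union), equipped with the topology $\mathscr{T}^Y$ having as a base of open sets the sets $V\times\{\omega\}$ with $V$ open in $X_{\mathbf{M}}$ and $\omega\in\Omega_{\mathbf{M}}$, $\mathbf{M}\in\mathfrak{M}$, and with the relation $\preccurlyeq$ defined by: $(x,\omega_1)\preccurlyeq(y,\omega_2)$ if $(x,y)\in r^{\mathbf{X}}$ for some $r\in R_{\omega_1,\omega_2}$. *)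

theory Defs
  imports "HOL-Analysis.Analysis"
begin

section \<open>Algebras of a common type\<close>

text \<open>
  A similarity type is given by the type \<open>'f\<close> of all its operation symbols together with
  \<open>ar :: 'f \<Rightarrow> nat\<close>.  The interpretation of \<open>f\<close> is only meaningful on argument lists of
  length \<open>ar f\<close> with entries in the universe.
\<close>

record ('f, 'a) alg =
  uni :: "'a set"
  opr :: "'f \<Rightarrow> 'a list \<Rightarrow> 'a"

definition args :: "('f \<Rightarrow> nat) \<Rightarrow> 'f \<Rightarrow> 'a set \<Rightarrow> 'a list set" where
  "args ar f S = {as. length as = ar f \<and> set as \<subseteq> S}"

definition is_alg :: "('f \<Rightarrow> nat) \<Rightarrow> ('f, 'a) alg \<Rightarrow> bool" where
  "is_alg ar A \<longleftrightarrow> uni A \<noteq> {} \<and> (\<forall>f. \<forall>as \<in> args ar f (uni A). opr A f as \<in> uni A)"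

definition subuniverse :: "('f \<Rightarrow> nat) \<Rightarrow> ('f, 'a) alg \<Rightarrow> 'a set \<Rightarrow> bool" where
  "subuniverse ar A S \<longleftrightarrow>
     S \<noteq> {} \<and> S \<subseteq> uni A \<and> (\<forall>f. \<forall>as \<in> args ar f S. opr A f as \<in> S)"

definition subalg :: "('f, 'a) alg \<Rightarrow> 'a set \<Rightarrow> ('f, 'a) alg" where
  "subalg A S = \<lparr>uni = S, opr = opr A\<rparr>"

definition prod_alg :: "('f, 'a) alg \<Rightarrow> ('f, 'b) alg \<Rightarrow> ('f, 'a \<times> 'b) alg" where
  "prod_alg A B = \<lparr>uni = uni A \<times> uni B,
     opr = (\<lambda>f ps. (opr A f (map fst ps), opr B f (map snd ps)))\<rparr>"

definition Prod_alg :: "'i set \<Rightarrow> ('i \<Rightarrow> ('f, 'a) alg) \<Rightarrow> ('f, 'i \<Rightarrow> 'a) alg" where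
  "Prod_alg I F = \<lparr>uni = (\<Pi>\<^sub>E i\<in>I. uni (F i)),
     opr = (\<lambda>f gs. \<lambda>i\<in>I. opr (F i) f (map (\<lambda>g. g i) gs))\<rparr>"

text \<open>
  Homomorphisms are taken to be extensional (undefined outside the domain universe), so that
  distinct elements of a hom-set are distinct maps on the universe.
\<close>

definition alg_hom :: "('f \<Rightarrow> nat) \<Rightarrow> ('f, 'a) alg \<Rightarrow> ('f, 'b) alg \<Rightarrow> ('a \<Rightarrow> 'b) set" where
  "alg_hom ar A B =
     {h \<in> uni A \<rightarrow>\<^sub>E uni B. \<forall>f. \<forall>as \<in> args ar f (uni A). h (opr A f as) = opr B f (map h as)}"

definition alg_iso :: "('f \<Rightarrow> nat) \<Rightarrow> ('f, 'a) alg \<Rightarrow> ('f, 'b) alg \<Rightarrow> bool" where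
  "alg_iso ar A B \<longleftrightarrow> (\<exists>h \<in> alg_hom ar A B. bij_betw h (uni A) (uni B))"

text \<open>
  The members of \<open>\<I>\<S>\<P>(\<MM>)\<close> whose universe is a set over \<open>'b\<close> and which arise from a product
  indexed by a set over \<open>'i\<close>.  A hypothesis \<open>A \<in> ISP TYPE('i) ar \<MM>\<close> of a theorem
  which is polymorphic in \<open>'i\<close> imposes no bound on the index set.  The index set may be empty.
\<close>

definition ISP :: "'i itself \<Rightarrow> ('f \<Rightarrow> nat) \<Rightarrow> ('f, 'a) alg set \<Rightarrow> ('f, 'b) alg set" where
  "ISP T ar \<MM> = {A. is_alg ar A \<and>
     (\<exists>(I :: 'i set) F S. F \<in> I \<rightarrow> \<MM> \<and> subuniverse ar (Prod_alg I F) S \<and>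
        alg_iso ar A (subalg (Prod_alg I F) S))}"


section \<open>Bounded distributive lattices\<close>

record 'a bdl =
  lcar :: "'a set"
  lmeet :: "'a \<Rightarrow> 'a \<Rightarrow> 'a"
  ljoin :: "'a \<Rightarrow> 'a \<Rightarrow> 'a"
  lzero :: 'a
  lone :: 'a

definition is_bdl :: "'a bdl \<Rightarrow> bool" where
  "is_bdl L \<longleftrightarrow>
     lzero L \<in> lcar L \<and> lone L \<in> lcar L \<and>
     (\<forall>x \<in> lcar L. \<forall>y \<in> lcar L. lmeet L x y \<in> lcar L \<and> ljoin L x y \<in> lcar L) \<and>
     (\<forall>x \<in> lcar L. \<forall>y \<in> lcar L. lmeet L x y = lmeet L y x \<and> ljoin L x y = ljoin L y x) \<and>
     (\<forall>x \<in> lcar L. \<forall>y \<in> lcar L. \<forall>z \<in> lcar L.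
        lmeet L (lmeet L x y) z = lmeet L x (lmeet L y z) \<and>
        ljoin L (ljoin L x y) z = ljoin L x (ljoin L y z)) \<and>
     (\<forall>x \<in> lcar L. \<forall>y \<in> lcar L. lmeet L x (ljoin L x y) = x \<and> ljoin L x (lmeet L x y) = x) \<and>
     (\<forall>x \<in> lcar L. \<forall>y \<in> lcar L. \<forall>z \<in> lcar L.
        lmeet L x (ljoin L y z) = ljoin L (lmeet L x y) (lmeet L x z)) \<and>
     (\<forall>x \<in> lcar L. ljoin L (lzero L) x = x \<and> lmeet L (lone L) x = x)"

definition bdl_hom :: "'a bdl \<Rightarrow> 'b bdl \<Rightarrow> ('a \<Rightarrow> 'b) set" where
  "bdl_hom L K =
     {h \<in> lcar L \<rightarrow>\<^sub>E lcar K.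
        (\<forall>x \<in> lcar L. \<forall>y \<in> lcar L.
           h (lmeet L x y) = lmeet K (h x) (h y) \<and> h (ljoin L x y) = ljoin K (h x) (h y)) \<and>
        h (lzero L) = lzero K \<and> h (lone L) = lone K}"

definition two :: "bool bdl" where
  "two = \<lparr>lcar = UNIV, lmeet = (\<and>), ljoin = (\<or>), lzero = False, lone = True\<rparr>"

lemma is_bdl_two: "is_bdl two"
  by (auto simp: is_bdl_def two_def)


section \<open>Algebras with a bounded distributive lattice reduct\<close>

datatype 'f trm = Var nat | App 'f "'f trm list"

text \<open>Well-formed terms in the variables \<open>Var 0, \<dots>, Var (n - 1)\<close>.\<close>

fun is_trm :: "('f \<Rightarrow> nat) \<Rightarrow> nat \<Rightarrow> 'f trm \<Rightarrow> bool" where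
  "is_trm ar n (Var i) \<longleftrightarrow> i < n"
| "is_trm ar n (App f ts) \<longleftrightarrow> length ts = ar f \<and> (\<forall>t \<in> set ts. is_trm ar n t)"

fun trm_val :: "('f, 'a) alg \<Rightarrow> 'a list \<Rightarrow> 'f trm \<Rightarrow> 'a" where
  "trm_val A xs (Var i) = xs ! i"
| "trm_val A xs (App f ts) = opr A f (map (trm_val A xs) ts)"

text \<open>
  A language containing \<open>\<and>, \<or>, 0, 1\<close> up to term-equivalence: the lattice operations are
  designated terms, binary for \<open>\<and>, \<or>\<close> and ground for \<open>0, 1\<close>, the same for all algebras
  of the type.
\<close>

record 'f lang =
  ari :: "'f \<Rightarrow> nat"
  tmeet :: "'f trm"
  tjoin :: "'f trm"
  tzero :: "'f trm"
  tone :: "'f trm"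

definition is_lang :: "'f lang \<Rightarrow> bool" where
  "is_lang \<L> \<longleftrightarrow>
     is_trm (ari \<L>) 2 (tmeet \<L>) \<and> is_trm (ari \<L>) 2 (tjoin \<L>) \<and>
     is_trm (ari \<L>) 0 (tzero \<L>) \<and> is_trm (ari \<L>) 0 (tone \<L>)"

definition reduct :: "'f lang \<Rightarrow> ('f, 'a) alg \<Rightarrow> 'a bdl" where
  "reduct \<L> A =
     \<lparr>lcar = uni A,
      lmeet = (\<lambda>x y. trm_val A [x, y] (tmeet \<L>)),
      ljoin = (\<lambda>x y. trm_val A [x, y] (tjoin \<L>)),
      lzero = trm_val A [] (tzero \<L>),
      lone = trm_val A [] (tone \<L>)\<rparr>"

definition D_based :: "'f lang \<Rightarrow> ('f, 'a) alg \<Rightarrow> bool" where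
  "D_based \<L> A \<longleftrightarrow> is_alg (ari \<L>) A \<and> is_bdl (reduct \<L> A)"


section \<open>Priestley spaces\<close>

definition priestley_space :: "'a topology \<Rightarrow> 'a rel \<Rightarrow> bool" where
  "priestley_space T r \<longleftrightarrow>
     compact_space T \<and> partial_order_on (topspace T) r \<and>
     (\<forall>x \<in> topspace T. \<forall>y \<in> topspace T. (x, y) \<notin> r \<longrightarrow>
        (\<exists>U. openin T U \<and> closedin T U \<and> (\<forall>u \<in> U. \<forall>v. (u, v) \<in> r \<longrightarrow> v \<in> U) \<and>
             x \<in> U \<and> y \<notin> U))"

definition priestley_iso ::
    "'a topology \<Rightarrow> 'a rel \<Rightarrow> 'b topology \<Rightarrow> 'b rel \<Rightarrow> bool" where
  "priestley_iso T r T' r' \<longleftrightarrow>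
     (\<exists>f. homeomorphic_map T T' f \<and>
        (\<forall>x \<in> topspace T. \<forall>y \<in> topspace T. (x, y) \<in> r \<longleftrightarrow> (f x, f y) \<in> r'))"

text \<open>The dual space of \<open>L\<close> has underlying set \<open>bdl_hom L two\<close>.\<close>

definition dual_top :: "'a bdl \<Rightarrow> ('a \<Rightarrow> bool) topology" where
  "dual_top L =
     subtopology (product_topology (\<lambda>_. discrete_topology UNIV) (lcar L)) (bdl_hom L two)"

definition dual_ord :: "'a bdl \<Rightarrow> ('a \<Rightarrow> bool) rel" where
  "dual_ord L =
     {(g, h). g \<in> bdl_hom L two \<and> h \<in> bdl_hom L two \<and> (\<forall>a \<in> lcar L. g a \<le> h a)}"

lemma topspace_dual_top: "topspace (dual_top L) = bdl_hom L two"
  by (auto simp: dual_top_def bdl_hom_def two_def)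

definition quotient_top :: "'a topology \<Rightarrow> 'a rel \<Rightarrow> 'a set topology" where
  "quotient_top T e =
     topology (\<lambda>V. V \<subseteq> topspace T // e \<and> openin T {x \<in> topspace T. e `` {x} \<in> V})"

definition quotient_ord :: "'a set \<Rightarrow> 'a rel \<Rightarrow> 'a rel \<Rightarrow> 'a set rel" where
  "quotient_ord Y e r =
     {(C, D). C \<in> Y // e \<and> D \<in> Y // e \<and> (\<exists>x \<in> C. \<exists>y \<in> D. (x, y) \<in> r)}"

lemma openin_quotient_top:
  "openin (quotient_top T e) V \<longleftrightarrow>
     V \<subseteq> topspace T // e \<and> openin T {x \<in> topspace T. e `` {x} \<in> V}"
proof -
  have "istopology (\<lambda>V. V \<subseteq> topspace T // e \<and> openin T {x \<in> topspace T. e `` {x} \<in> V})"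
    unfolding istopology_def
  proof (intro conjI allI impI)
    fix S S' assume "S \<subseteq> topspace T // e \<and> openin T {x \<in> topspace T. e `` {x} \<in> S}"
      and "S' \<subseteq> topspace T // e \<and> openin T {x \<in> topspace T. e `` {x} \<in> S'}"
    moreover have "{x \<in> topspace T. e `` {x} \<in> S \<inter> S'} =
        {x \<in> topspace T. e `` {x} \<in> S} \<inter> {x \<in> topspace T. e `` {x} \<in> S'}" by auto
    ultimately show "S \<inter> S' \<subseteq> topspace T // e"
      and "openin T {x \<in> topspace T. e `` {x} \<in> S \<inter> S'}" by auto
  next
    fix \<K> assume "\<forall>K\<in>\<K>. K \<subseteq> topspace T // e \<and> openin T {x \<in> topspace T. e `` {x} \<in> K}"
    moreover have "{x \<in> topspace T. e `` {x} \<in> \<Union> \<K>} =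
        (\<Union>K\<in>\<K>. {x \<in> topspace T. e `` {x} \<in> K})" by auto
    ultimately show "\<Union> \<K> \<subseteq> topspace T // e"
      and "openin T {x \<in> topspace T. e `` {x} \<in> \<Union> \<K>}" by auto
  qed
  then show ?thesis
    by (simp add: quotient_top_def)
qed

lemma topspace_quotient_top: "topspace (quotient_top T e) = topspace T // e"
proof -
  have "{x \<in> topspace T. e `` {x} \<in> topspace T // e} = topspace T"
    by (auto simp: quotient_def)
  then have "openin (quotient_top T e) (topspace T // e)"
    by (simp add: openin_quotient_top)
  then show ?thesis
    by (meson openin_quotient_top openin_subset openin_topspace subset_antisym)
qed

lemma quotient_map_quotient_top: "quotient_map T (quotient_top T e) (\<lambda>x. e `` {x})"
  unfolding quotient_map_def topspace_quotient_top openin_quotient_top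
  by (auto simp: quotient_def)


section \<open>The structure associated with an algebra\<close>

definition Sep ::
    "'f lang \<Rightarrow> ('f, 'a) alg set \<Rightarrow> (('f, 'a) alg \<Rightarrow> ('a \<Rightarrow> bool) set) \<Rightarrow> bool" where
  "Sep \<L> \<MM> \<Omega> \<longleftrightarrow>
     (\<forall>M \<in> \<MM>. \<forall>a \<in> uni M. \<forall>b \<in> uni M. a \<noteq> b \<longrightarrow>
        (\<exists>M' \<in> \<MM>. \<exists>u \<in> alg_hom (ari \<L>) M M'. \<exists>\<omega> \<in> \<Omega> M'. \<omega> (u a) \<noteq> \<omega> (u b)))"

text \<open>Subalgebras of \<open>M\<^sub>1 \<times> M\<^sub>2\<close> are represented by their universes.\<close>

definition below :: "('f, 'a) alg \<Rightarrow> ('a \<Rightarrow> bool) \<Rightarrow> ('f, 'a) alg \<Rightarrow> ('a \<Rightarrow> bool) \<Rightarrow> 'a rel" where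
  "below M1 \<omega>1 M2 \<omega>2 = {(a, b). a \<in> uni M1 \<and> b \<in> uni M2 \<and> \<omega>1 a \<le> \<omega>2 b}"

definition Rmax ::
    "'f lang \<Rightarrow> ('f, 'a) alg \<Rightarrow> ('a \<Rightarrow> bool) \<Rightarrow> ('f, 'a) alg \<Rightarrow> ('a \<Rightarrow> bool) \<Rightarrow> 'a rel set" where
  "Rmax \<L> M1 \<omega>1 M2 \<omega>2 =
     {r. subuniverse (ari \<L>) (prod_alg M1 M2) r \<and> r \<subseteq> below M1 \<omega>1 M2 \<omega>2 \<and>
         (\<forall>s. subuniverse (ari \<L>) (prod_alg M1 M2) s \<and> s \<subseteq> below M1 \<omega>1 M2 \<omega>2 \<and> r \<subseteq> s
              \<longrightarrow> s = r)}"

definition Xtop :: "'f lang \<Rightarrow> ('f, 'b) alg \<Rightarrow> ('f, 'a) alg \<Rightarrow> ('b \<Rightarrow> 'a) topology" where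
  "Xtop \<L> A M =
     subtopology (product_topology (\<lambda>_. discrete_topology (uni M)) (uni A))
       (alg_hom (ari \<L>) A M)"

lemma topspace_Xtop: "topspace (Xtop \<L> A M) = alg_hom (ari \<L>) A M"
  by (auto simp: Xtop_def alg_hom_def)

text \<open>The points of \<open>Y\<close> carry the member of \<open>\<MM>\<close> as a tag, to make the union disjoint.\<close>

definition Yset ::
    "'f lang \<Rightarrow> ('f, 'a) alg set \<Rightarrow> (('f, 'a) alg \<Rightarrow> ('a \<Rightarrow> bool) set) \<Rightarrow> ('f, 'b) alg \<Rightarrow>
      (('f, 'a) alg \<times> ('b \<Rightarrow> 'a) \<times> ('a \<Rightarrow> bool)) set" where
  "Yset \<L> \<MM> \<Omega> A = (SIGMA M:\<MM>. alg_hom (ari \<L>) A M \<times> \<Omega> M)"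

definition Ybase ::
    "'f lang \<Rightarrow> ('f, 'a) alg set \<Rightarrow> (('f, 'a) alg \<Rightarrow> ('a \<Rightarrow> bool) set) \<Rightarrow> ('f, 'b) alg \<Rightarrow>
      (('f, 'a) alg \<times> ('b \<Rightarrow> 'a) \<times> ('a \<Rightarrow> bool)) set set" where
  "Ybase \<L> \<MM> \<Omega> A = {{M} \<times> V \<times> {\<omega>} | M V \<omega>. M \<in> \<MM> \<and> openin (Xtop \<L> A M) V \<and> \<omega> \<in> \<Omega> M}"

definition Ytop ::
    "'f lang \<Rightarrow> ('f, 'a) alg set \<Rightarrow> (('f, 'a) alg \<Rightarrow> ('a \<Rightarrow> bool) set) \<Rightarrow> ('f, 'b) alg \<Rightarrow>
      (('f, 'a) alg \<times> ('b \<Rightarrow> 'a) \<times> ('a \<Rightarrow> bool)) topology" where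
  "Ytop \<L> \<MM> \<Omega> A = topology (arbitrary union_of (\<lambda>U. U \<in> Ybase \<L> \<MM> \<Omega> A))"

definition Yord ::
    "'f lang \<Rightarrow> ('f, 'a) alg set \<Rightarrow> (('f, 'a) alg \<Rightarrow> ('a \<Rightarrow> bool) set) \<Rightarrow> ('f, 'b) alg \<Rightarrow>
      (('f, 'a) alg \<times> ('b \<Rightarrow> 'a) \<times> ('a \<Rightarrow> bool)) rel" where
  "Yord \<L> \<MM> \<Omega> A =
     {((M1, x, \<omega>1), (M2, y, \<omega>2)).
        (M1, x, \<omega>1) \<in> Yset \<L> \<MM> \<Omega> A \<and> (M2, y, \<omega>2) \<in> Yset \<L> \<MM> \<Omega> A \<and>
        (\<exists>r \<in> Rmax \<L> M1 \<omega>1 M2 \<omega>2. \<forall>a \<in> uni A. (x a, y a) \<in> r)}"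

definition Yequiv ::
    "'f lang \<Rightarrow> ('f, 'a) alg set \<Rightarrow> (('f, 'a) alg \<Rightarrow> ('a \<Rightarrow> bool) set) \<Rightarrow> ('f, 'b) alg \<Rightarrow>
      (('f, 'a) alg \<times> ('b \<Rightarrow> 'a) \<times> ('a \<Rightarrow> bool)) rel" where
  "Yequiv \<L> \<MM> \<Omega> A = Yord \<L> \<MM> \<Omega> A \<inter> (Yord \<L> \<MM> \<Omega> A)\<inverse>"

lemma openin_Ytop: "openin (Ytop \<L> \<MM> \<Omega> A) = arbitrary union_of (\<lambda>U. U \<in> Ybase \<L> \<MM> \<Omega> A)"
proof -
  have "istopology (arbitrary union_of (\<lambda>U. U \<in> Ybase \<L> \<MM> \<Omega> A))"
    unfolding istopology_base_eq
  proof (intro allI impI)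
    fix S T assume *: "S \<in> Ybase \<L> \<MM> \<Omega> A \<and> T \<in> Ybase \<L> \<MM> \<Omega> A"
    show "(arbitrary union_of (\<lambda>U. U \<in> Ybase \<L> \<MM> \<Omega> A)) (S \<inter> T)"
    proof (cases "S \<inter> T = {}")
      case True
      then show ?thesis by (simp add: arbitrary_union_of_empty)
    next
      case False
      obtain M V \<omega> where S: "S = {M} \<times> V \<times> {\<omega>}" "M \<in> \<MM>" "openin (Xtop \<L> A M) V" "\<omega> \<in> \<Omega> M"
        using * unfolding Ybase_def by blast
      obtain M' V' \<omega>' where T: "T = {M'} \<times> V' \<times> {\<omega>'}" "openin (Xtop \<L> A M') V'"
        using * unfolding Ybase_def by blast
      have eq: "M' = M" "\<omega>' = \<omega>" using False S T by auto
      have "S \<inter> T = {M} \<times> (V \<inter> V') \<times> {\<omega>}" using S T eq by auto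
      moreover have "openin (Xtop \<L> A M) (V \<inter> V')" using S T eq by auto
      ultimately have "S \<inter> T \<in> Ybase \<L> \<MM> \<Omega> A"
        using S unfolding Ybase_def by blast
      then show ?thesis by (simp add: union_of_inc arbitrary_def)
    qed
  qed
  then show ?thesis by (simp add: Ytop_def)
qed

lemma topspace_Ytop: "topspace (Ytop \<L> \<MM> \<Omega> A) = Yset \<L> \<MM> \<Omega> A"
proof
  have "U \<subseteq> Yset \<L> \<MM> \<Omega> A" if "U \<in> Ybase \<L> \<MM> \<Omega> A" for U
    using that openin_subset[of "Xtop \<L> A _"]
    unfolding Ybase_def Yset_def topspace_Xtop by blast
  then have "U \<subseteq> Yset \<L> \<MM> \<Omega> A" if "openin (Ytop \<L> \<MM> \<Omega> A) U" for U
    using that unfolding openin_Ytop union_of_def by blast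
  then show "topspace (Ytop \<L> \<MM> \<Omega> A) \<subseteq> Yset \<L> \<MM> \<Omega> A"
    by blast
  show "Yset \<L> \<MM> \<Omega> A \<subseteq> topspace (Ytop \<L> \<MM> \<Omega> A)"
  proof
    fix p assume "p \<in> Yset \<L> \<MM> \<Omega> A"
    then obtain M x \<omega> where p: "p = (M, x, \<omega>)" "M \<in> \<MM>" "x \<in> alg_hom (ari \<L>) A M" "\<omega> \<in> \<Omega> M"
      unfolding Yset_def by blast
    have "{M} \<times> topspace (Xtop \<L> A M) \<times> {\<omega>} \<in> Ybase \<L> \<MM> \<Omega> A"
      using p unfolding Ybase_def by blast
    then have "openin (Ytop \<L> \<MM> \<Omega> A) ({M} \<times> topspace (Xtop \<L> A M) \<times> {\<omega>})"
      by (simp add: openin_Ytop union_of_inc arbitrary_def)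
    from openin_subset[OF this] p show "p \<in> topspace (Ytop \<L> \<MM> \<Omega> A)"
      by (auto simp: topspace_Xtop)
  qed
qed

end

theory Submission
  imports Defs
begin

text \<open>
  Evaluation \<open>\<Phi> (M, x, \<omega>) = \<omega> \<circ> x\<close> maps \<open>Y\<close> into the dual space of \<open>U(A)\<close>.  Because the members
  of \<open>\<MM>\<close> are finite, the subalgebra \<open>{(x a, y a) | a \<in> A}\<close> lies in a maximal one as soon as it is
  contained in \<open>(\<omega>\<^sub>1, \<omega>\<^sub>2)\<inverse>(\<le>)\<close>; hence \<open>\<preceq>\<close> is the preimage of the pointwise order under \<open>\<Phi>\<close>.  The space
  \<open>Y\<close> is compact by Tychonoff's theorem.  By (Sep) the points \<open>\<Phi> p\<close> separate the elements of \<open>A\<close>, so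
  finitely many values of a prescribed lattice homomorphism are always realised by some \<open>\<Phi> p\<close>, and by
  compactness all of them are.  The induced continuous bijection from the compact quotient to
  the Hausdorff dual space is a homeomorphism.
\<close>

section \<open>Topological preliminaries\<close>

text \<open>If agreement with \<open>h\<close> on finitely many coordinates already excludes
  membership in \<open>S\<close>, the cylinder fixing these coordinates is a basic neighbourhood of
  \<open>h\<close> avoiding \<open>S\<close>. Intersecting \<open>K\<close> with \<open>I\<close>
  spares users from checking that \<open>K\<close> consists of indices.\<close>

lemma closedin_product_discrete:
  assumes "S \<subseteq> (\<Pi>\<^sub>E i\<in>I. X i)"
    and loc: "\<And>h. h \<in> (\<Pi>\<^sub>E i\<in>I. X i) - S \<Longrightarrow>
      \<exists>K. finite K \<and> (\<forall>g \<in> \<Pi>\<^sub>E i\<in>I. X i. (\<forall>i \<in> K \<inter> I. g i = h i) \<longrightarrow> g \<notin> S)"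
  shows "closedin (product_topology (\<lambda>i. discrete_topology (X i)) I) S"
proof -
  have "openin (product_topology (\<lambda>i. discrete_topology (X i)) I) ((\<Pi>\<^sub>E i\<in>I. X i) - S)"
    unfolding openin_product_topology_alt
  proof
    fix h assume h: "h \<in> (\<Pi>\<^sub>E i\<in>I. X i) - S"
    then obtain K where K: "finite K"
        "\<And>g. g \<in> (\<Pi>\<^sub>E i\<in>I. X i) \<Longrightarrow> (\<forall>i \<in> K \<inter> I. g i = h i) \<Longrightarrow> g \<notin> S"
      using loc[OF h] by blast
    define U where "U = (\<lambda>i. if i \<in> K then {h i} else X i)"
    have "{i \<in> I. U i \<noteq> topspace (discrete_topology (X i))} \<subseteq> K"
      by (auto simp: U_def)
    then have "finite {i \<in> I. U i \<noteq> topspace (discrete_topology (X i))}"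
      using K(1) finite_subset by blast
    moreover have sub: "U i \<subseteq> X i" if "i \<in> I" for i
      using h that by (auto simp: U_def)
    moreover have "h \<in> Pi\<^sub>E I U"
      using h by (auto simp: U_def PiE_iff)
    moreover have "Pi\<^sub>E I U \<subseteq> (\<Pi>\<^sub>E i\<in>I. X i) - S"
    proof
      fix g assume g: "g \<in> Pi\<^sub>E I U"
      have "g \<in> (\<Pi>\<^sub>E i\<in>I. X i)"
        using g PiE_mono[of I U X] sub by blast
      moreover have "g i = h i" if "i \<in> K \<inter> I" for i
        using PiE_mem[OF g, of i] that by (auto simp: U_def)
      ultimately show "g \<in> (\<Pi>\<^sub>E i\<in>I. X i) - S"
        using K(2)[of g] by simp
    qed
    ultimately show "\<exists>U. finite {i \<in> I. U i \<noteq> topspace (discrete_topology (X i))} \<and>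
        (\<forall>i\<in>I. openin (discrete_topology (X i)) (U i)) \<and> h \<in> Pi\<^sub>E I U \<and>
        Pi\<^sub>E I U \<subseteq> (\<Pi>\<^sub>E i\<in>I. X i) - S"
      unfolding openin_discrete_topology by blast
  qed
  then show ?thesis
    using assms(1) by (simp add: closedin_def)
qed

text \<open>Reflexivity and transitivity survive taking preimages. Antisymmetry does not, as
  \<open>f\<close> may identify points, so a partial order pulls back only to a pre-order; with
  evaluation as \<open>f\<close> this is assertion (ii).\<close>

lemma preorder_on_pullback:
  assumes "r \<subseteq> Y \<times> Y" "partial_order_on Z r'" "f ` Y \<subseteq> Z"
    and "\<And>x y. x \<in> Y \<Longrightarrow> y \<in> Y \<Longrightarrow> (x, y) \<in> r \<longleftrightarrow> (f x, f y) \<in> r'"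
  shows "preorder_on Y r"
proof -
  have "refl_on Y r"
    using assms(3,4) partial_order_onD(1)[OF assms(2)] by (auto simp: refl_on_def)
  moreover have "trans r"
  proof (rule transI)
    fix x y z assume *: "(x, y) \<in> r" "(y, z) \<in> r"
    then have "x \<in> Y" "y \<in> Y" "z \<in> Y"
      using assms(1) by auto
    then show "(x, z) \<in> r"
      using * assms(4) transD[OF partial_order_onD(2)[OF assms(2)]] by meson
  qed
  ultimately show ?thesis
    using assms(1) by (simp add: preorder_on_def)
qed

text \<open>Separating clopen up-sets pull back along \<open>f\<close>, and injectivity of
  \<open>f\<close> restores antisymmetry. Since \<open>ord\<close> is silent about pairs outside the
  space, \<open>r\<close> is assumed to contain none.\<close>

lemma priestley_space_iso:
  assumes f: "homeomorphic_map T T' f"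
    and ord: "\<And>x y. x \<in> topspace T \<Longrightarrow> y \<in> topspace T \<Longrightarrow> (x, y) \<in> r \<longleftrightarrow> (f x, f y) \<in> r'"
    and r: "r \<subseteq> topspace T \<times> topspace T"
    and T': "priestley_space T' r'"
  shows "priestley_space T r"
proof -
  have inj: "inj_on f (topspace T)" and cont: "continuous_map T T' f"
    using f by (simp_all add: homeomorphic_eq_everything_map)
  have fin: "f x \<in> topspace T'" if "x \<in> topspace T" for x
    using cont that by (auto simp: continuous_map_def)
  have po: "partial_order_on (topspace T') r'" and cT': "compact_space T'"
    using T' by (auto simp: priestley_space_def)
  have "compact_space T"
    using cT' f homeomorphic_compact_space homeomorphic_map_imp_homeomorphic_space by blast
  moreover have "partial_order_on (topspace T) r"
  proof -
    have "preorder_on (topspace T) r"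
      using preorder_on_pullback[OF r po _ ord] fin by blast
    moreover have "antisym r"
    proof (rule antisymI)
      fix x y assume *: "(x, y) \<in> r" "(y, x) \<in> r"
      then have xy: "x \<in> topspace T" "y \<in> topspace T"
        using r by auto
      then have "f x = f y"
        using * ord[of x y] ord[of y x] antisymD[OF partial_order_onD(3)[OF po]] by blast
      then show "x = y"
        by (rule inj_onD[OF inj _ xy])
    qed
    ultimately show ?thesis
      by (simp add: partial_order_on_def)
  qed
  moreover have "\<exists>U. openin T U \<and> closedin T U \<and> (\<forall>u \<in> U. \<forall>v. (u, v) \<in> r \<longrightarrow> v \<in> U) \<and>
      x \<in> U \<and> y \<notin> U" if xy: "x \<in> topspace T" "y \<in> topspace T" "(x, y) \<notin> r" for x y
  proof -
    obtain U where U: "openin T' U" "closedin T' U"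
        "\<And>u v. u \<in> U \<Longrightarrow> (u, v) \<in> r' \<Longrightarrow> v \<in> U" "f x \<in> U" "f y \<notin> U"
      using T'[unfolded priestley_space_def] fin[OF xy(1)] fin[OF xy(2)] xy(3) ord[OF xy(1,2)]
      by meson
    let ?V = "{z \<in> topspace T. f z \<in> U}"
    have "openin T ?V" "closedin T ?V"
      using openin_continuous_map_preimage[OF cont U(1)] closedin_continuous_map_preimage[OF cont U(2)]
      by simp_all
    moreover have "v \<in> ?V" if "u \<in> ?V" "(u, v) \<in> r" for u v
    proof -
      have v: "v \<in> topspace T" and "(f u, f v) \<in> r'"
        using that r ord[of u v] by auto
      then show ?thesis
        using U(3)[of "f u" "f v"] that by simp
    qed
    ultimately have "openin T ?V \<and> closedin T ?V \<and> (\<forall>u \<in> ?V. \<forall>v. (u, v) \<in> r \<longrightarrow> v \<in> ?V) \<and>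
        x \<in> ?V \<and> y \<notin> ?V"
      using xy(1) U(4,5) by blast
    then show ?thesis ..
  qed
  ultimately show ?thesis
    unfolding priestley_space_def by simp
qed

section \<open>Terms and lattice reducts\<close>

lemma trm_val_in_uni:
  assumes "is_alg ar A" "is_trm ar n t" "set xs \<subseteq> uni A" "length xs = n"
  shows "trm_val A xs t \<in> uni A"
  using assms(2)
proof (induction t)
  case (Var i)
  then show ?case using assms(3,4) by (auto simp: subset_eq)
next
  case (App f ts)
  then have "map (trm_val A xs) ts \<in> args ar f (uni A)"
    by (auto simp: args_def)
  then show ?case
    using assms(1) by (auto simp: is_alg_def)
qed

lemma alg_hom_trm_val:
  assumes A: "is_alg ar A" and h: "h \<in> alg_hom ar A B"
    and "is_trm ar n t" and xs: "set xs \<subseteq> uni A" "length xs = n"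
  shows "h (trm_val A xs t) = trm_val B (map h xs) t"
  using assms(3)
proof (induction t)
  case (Var i)
  then show ?case using xs by simp
next
  case (App f ts)
  then have "map (trm_val A xs) ts \<in> args ar f (uni A)"
    using trm_val_in_uni[OF A _ xs] by (auto simp: args_def)
  then have "h (trm_val A xs (App f ts)) = opr B f (map h (map (trm_val A xs) ts))"
    using h by (simp add: alg_hom_def)
  also have "map h (map (trm_val A xs) ts) = map (trm_val B (map h xs)) ts"
    using App by simp
  finally show ?case by simp
qed

text \<open>Closure comes from the lattice operations being terms, so it is available for any
  algebra of the type, in particular for members of \<open>ISP\<close>.\<close>

lemma reduct_closed:
  assumes "is_lang \<L>" "is_alg (ari \<L>) A"
  shows "lzero (reduct \<L> A) \<in> uni A" "lone (reduct \<L> A) \<in> uni A"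
    "x \<in> uni A \<Longrightarrow> y \<in> uni A \<Longrightarrow> lmeet (reduct \<L> A) x y \<in> uni A"
    "x \<in> uni A \<Longrightarrow> y \<in> uni A \<Longrightarrow> ljoin (reduct \<L> A) x y \<in> uni A"
  using assms trm_val_in_uni[OF assms(2)] by (auto simp: reduct_def is_lang_def)

lemma lcar_reduct [simp]: "lcar (reduct \<L> A) = uni A"
  by (simp add: reduct_def)

text \<open>Homomorphisms commute with term values, and the lattice operations are the same terms in
  both algebras. This is the forgetful functor on maps.\<close>

lemma alg_hom_imp_bdl_hom:
  assumes "is_lang \<L>" "is_alg (ari \<L>) A" "h \<in> alg_hom (ari \<L>) A B"
  shows "h \<in> bdl_hom (reduct \<L> A) (reduct \<L> B)"
proof -
  have "h \<in> uni A \<rightarrow>\<^sub>E uni B"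
    using assms(3) by (simp add: alg_hom_def)
  moreover have "h (trm_val A [x, y] (tmeet \<L>)) = trm_val B [h x, h y] (tmeet \<L>)"
      "h (trm_val A [x, y] (tjoin \<L>)) = trm_val B [h x, h y] (tjoin \<L>)"
    if "x \<in> uni A" "y \<in> uni A" for x y
    using that assms(1) alg_hom_trm_val[OF assms(2,3), of 2 _ "[x, y]"] by (auto simp: is_lang_def)
  moreover have "h (trm_val A [] (tzero \<L>)) = trm_val B [] (tzero \<L>)"
      "h (trm_val A [] (tone \<L>)) = trm_val B [] (tone \<L>)"
    using assms(1) alg_hom_trm_val[OF assms(2,3), of 0 _ "[]"] by (auto simp: is_lang_def)
  ultimately show ?thesis
    by (simp add: bdl_hom_def reduct_def)
qed

text \<open>The conditions on the right say that \<open>h\<close> is the characteristic function of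
  a prime filter; in this propositional form they suit automation.\<close>

lemma bdl_hom_two_iff:
  "h \<in> bdl_hom L two \<longleftrightarrow>
     h \<in> extensional (lcar L) \<and>
     (\<forall>x \<in> lcar L. \<forall>y \<in> lcar L.
        (h (lmeet L x y) \<longleftrightarrow> h x \<and> h y) \<and> (h (ljoin L x y) \<longleftrightarrow> h x \<or> h y)) \<and>
     \<not> h (lzero L) \<and> h (lone L)"
  by (auto simp: bdl_hom_def two_def PiE_iff)

lemma alg_hom_compose:
  assumes "is_alg ar A" "g \<in> alg_hom ar A B" "h \<in> alg_hom ar B C"
  shows "(\<lambda>a \<in> uni A. h (g a)) \<in> alg_hom ar A C"
proof -
  have g: "g \<in> uni A \<rightarrow> uni B" and h: "h \<in> uni B \<rightarrow> uni C"
    using assms by (auto simp: alg_hom_def)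
  have "(\<lambda>a \<in> uni A. h (g a)) (opr A f as) = opr C f (map (\<lambda>a \<in> uni A. h (g a)) as)"
    if as: "as \<in> args ar f (uni A)" for f as
  proof -
    have "map g as \<in> args ar f (uni B)"
      using as g by (auto simp: args_def)
    moreover have "opr A f as \<in> uni A"
      using assms(1) as by (auto simp: is_alg_def)
    moreover have "map (\<lambda>a \<in> uni A. h (g a)) as = map h (map g as)"
      using as by (auto simp: args_def)
    ultimately show ?thesis
      using assms(2,3) as by (simp add: alg_hom_def del: map_map map_eq_conv)
  qed
  then show ?thesis
    using g h by (auto simp: alg_hom_def)
qed

text \<open>An embedding into a product keeps \<open>a\<close> and \<open>b\<close> distinct, so
  their images differ at some coordinate; the embedding followed by that projection separates
  them.\<close>

lemma ISP_separates:
  assumes "A \<in> ISP TYPE('i) ar \<MM>" "a \<in> uni A" "b \<in> uni A" "a \<noteq> b"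
  obtains M h where "M \<in> \<MM>" "h \<in> alg_hom ar A M" "h a \<noteq> h b"
proof -
  obtain I :: "'i set" and F S e where F: "F \<in> I \<rightarrow> \<MM>" and S: "subuniverse ar (Prod_alg I F) S"
    and e: "e \<in> alg_hom ar A (subalg (Prod_alg I F) S)" and bij: "bij_betw e (uni A) S"
    and A: "is_alg ar A"
    using assms(1) by (auto simp: ISP_def alg_iso_def subalg_def)
  have SF: "S \<subseteq> (\<Pi>\<^sub>E i\<in>I. uni (F i))"
    using S by (auto simp: subuniverse_def Prod_alg_def)
  have eS: "e c \<in> S" if "c \<in> uni A" for c
    using bij that by (auto simp: bij_betw_def)
  have "e a \<noteq> e b"
    using bij assms(2-4) by (auto simp: bij_betw_def dest: inj_onD)
  then obtain i where i: "i \<in> I" "e a i \<noteq> e b i"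
    using eS SF assms(2,3) by (meson PiE_ext subsetD)
  let ?h = "\<lambda>c \<in> uni A. e c i"
  have "?h (opr A f as) = opr (F i) f (map ?h as)" if as: "as \<in> args ar f (uni A)" for f as
  proof -
    have "opr A f as \<in> uni A"
      using A as by (auto simp: is_alg_def)
    moreover have "e (opr A f as) = (\<lambda>i\<in>I. opr (F i) f (map (\<lambda>g. g i) (map e as)))"
      using e as by (auto simp: alg_hom_def subalg_def Prod_alg_def)
    moreover have "map ?h as = map (\<lambda>g. g i) (map e as)"
      using as by (auto simp: args_def)
    ultimately show ?thesis
      using i by (simp del: map_map map_eq_conv)
  qed
  moreover have "?h \<in> uni A \<rightarrow>\<^sub>E uni (F i)"
    using eS SF i by (auto simp: PiE_iff subset_iff)
  ultimately have "?h \<in> alg_hom ar A (F i)"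
    by (simp add: alg_hom_def)
  then show ?thesis
    using that[of "F i" ?h] F i assms(2,3) by auto
qed

section \<open>The dual space\<close>

lemma Hausdorff_space_dual_top: "Hausdorff_space (dual_top L)"
  by (simp add: dual_top_def Hausdorff_space_subtopology Hausdorff_space_product_topology)

lemma continuous_map_dual_eval:
  assumes "a \<in> lcar L"
  shows "continuous_map (dual_top L) (discrete_topology UNIV) (\<lambda>g. g a)"
  unfolding dual_top_def
  using continuous_map_product_projection[OF assms, of "\<lambda>_. discrete_topology UNIV"]
  by (rule continuous_map_from_subtopology)

text \<open>If \<open>g \<le> h\<close> fails, some \<open>a\<close> has \<open>g a\<close> true and
  \<open>h a\<close> false, and the maps true at \<open>a\<close> form a clopen up-set. Compactness
  is a hypothesis because it will be inherited from Y through evaluation.\<close>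

lemma priestley_space_dual:
  assumes "compact_space (dual_top L)"
  shows "priestley_space (dual_top L) (dual_ord L)"
proof -
  have "partial_order_on (bdl_hom L two) (dual_ord L)"
  proof -
    have "antisym (dual_ord L)"
    proof (rule antisymI)
      fix g h assume "(g, h) \<in> dual_ord L" "(h, g) \<in> dual_ord L"
      then have "g \<in> extensional (lcar L)" "h \<in> extensional (lcar L)" "\<And>a. a \<in> lcar L \<Longrightarrow> g a = h a"
        by (auto simp: dual_ord_def bdl_hom_two_iff)
      then show "g = h"
        by (rule extensionalityI)
    qed
    then show ?thesis
      by (auto simp: partial_order_on_def preorder_on_def refl_on_def dual_ord_def trans_def)
  qed
  moreover have "\<exists>U. openin (dual_top L) U \<and> closedin (dual_top L) U \<and>
      (\<forall>u \<in> U. \<forall>v. (u, v) \<in> dual_ord L \<longrightarrow> v \<in> U) \<and> g \<in> U \<and> h \<notin> U"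
    if gh: "g \<in> bdl_hom L two" "h \<in> bdl_hom L two" "(g, h) \<notin> dual_ord L" for g h
  proof -
    obtain a where a: "a \<in> lcar L" "g a" "\<not> h a"
      using gh by (auto simp: dual_ord_def)
    let ?U = "{f \<in> topspace (dual_top L). f a \<in> {True}}"
    have "openin (dual_top L) ?U" "closedin (dual_top L) ?U"
      using continuous_map_dual_eval[OF a(1)]
      by (rule openin_continuous_map_preimage closedin_continuous_map_preimage; simp)+
    moreover have "\<forall>u \<in> ?U. \<forall>v. (u, v) \<in> dual_ord L \<longrightarrow> v \<in> ?U"
      using a by (auto simp: dual_ord_def topspace_dual_top)
    ultimately show ?thesis
      using a gh by (intro exI[of _ ?U]) (auto simp: topspace_dual_top)
  qed
  ultimately show ?thesis
    using assms by (simp add: priestley_space_def topspace_dual_top)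
qed

section \<open>The topology of \<open>Y\<close>\<close>

text \<open>Failure to be a homomorphism is witnessed by one operation and one argument list, hence
  by finitely many values of the map.\<close>

lemma closedin_alg_hom:
  assumes "is_alg ar A"
  shows "closedin (product_topology (\<lambda>_. discrete_topology (uni M)) (uni A)) (alg_hom ar A M)"
proof (rule closedin_product_discrete)
  show "alg_hom ar A M \<subseteq> (\<Pi>\<^sub>E i\<in>uni A. uni M)"
    by (auto simp: alg_hom_def)
  fix h assume h: "h \<in> (\<Pi>\<^sub>E i\<in>uni A. uni M) - alg_hom ar A M"
  then obtain f as where as: "as \<in> args ar f (uni A)" "h (opr A f as) \<noteq> opr M f (map h as)"
    by (auto simp: alg_hom_def)
  have opA: "opr A f as \<in> uni A" and sub: "set as \<subseteq> uni A"
    using assms as by (auto simp: is_alg_def args_def)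
  have disagree: "g \<notin> alg_hom ar A M" if g: "\<forall>i \<in> insert (opr A f as) (set as) \<inter> uni A. g i = h i" for g
  proof
    assume "g \<in> alg_hom ar A M"
    then have "g (opr A f as) = opr M f (map g as)"
      using as by (auto simp: alg_hom_def)
    moreover have "map g as = map h as"
      using g sub by auto
    ultimately show False
      using g as(2) opA by simp
  qed
  show "\<exists>K. finite K \<and>
      (\<forall>g \<in> \<Pi>\<^sub>E i\<in>uni A. uni M. (\<forall>i \<in> K \<inter> uni A. g i = h i) \<longrightarrow> g \<notin> alg_hom ar A M)"
    by (intro exI[of _ "insert (opr A f as) (set as)"] conjI ballI impI,
        simp, erule disagree)
qed

lemma compact_space_Xtop:
  assumes "is_alg (ari \<L>) A" "finite (uni M)"
  shows "compact_space (Xtop \<L> A M)"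
proof -
  have "compact_space (product_topology (\<lambda>_. discrete_topology (uni M)) (uni A))"
    using assms(2) by (simp add: compact_space_product_topology compact_space_discrete_topology)
  then show ?thesis
    unfolding Xtop_def
    by (intro compact_space_subtopology closedin_compact_space[OF _ closedin_alg_hom[OF assms(1)]])
qed

lemma Hausdorff_space_Xtop: "Hausdorff_space (Xtop \<L> A M)"
  by (simp add: Xtop_def Hausdorff_space_subtopology Hausdorff_space_product_topology)

text \<open>This exhibits Y as the topological sum of its sheets, one copy of
  \<open>Xtop \<L> A M\<close> for each pair \<open>M\<close>, \<open>\<omega>\<close>.\<close>

lemma openin_Ytop_iff:
  "openin (Ytop \<L> \<MM> \<Omega> A) W \<longleftrightarrow>
     W \<subseteq> Yset \<L> \<MM> \<Omega> A \<and> (\<forall>M \<in> \<MM>. \<forall>\<omega> \<in> \<Omega> M. openin (Xtop \<L> A M) {x. (M, x, \<omega>) \<in> W})"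
proof
  assume W: "openin (Ytop \<L> \<MM> \<Omega> A) W"
  then obtain \<U> where \<U>: "\<U> \<subseteq> Ybase \<L> \<MM> \<Omega> A" "W = \<Union>\<U>"
    by (auto simp: openin_Ytop union_of_def arbitrary_def)
  \<comment> \<open>A basic set meets a given sheet either in its own open set or not at
    all.\<close>
  have "openin (Xtop \<L> A M) {x. (M, x, \<omega>) \<in> U}" if U: "U \<in> \<U>" for M \<omega> U
  proof -
    obtain M' V \<omega>' where "U = {M'} \<times> V \<times> {\<omega>'}" "openin (Xtop \<L> A M') V"
      using subsetD[OF \<U>(1) U] unfolding Ybase_def by blast
    then show ?thesis
      by (cases "M = M' \<and> \<omega> = \<omega>'") auto
  qed
  then have "openin (Xtop \<L> A M) (\<Union>U\<in>\<U>. {x. (M, x, \<omega>) \<in> U})" for M \<omega>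
    by blast
  moreover have "(\<Union>U\<in>\<U>. {x. (M, x, \<omega>) \<in> U}) = {x. (M, x, \<omega>) \<in> W}" for M \<omega>
    using \<U>(2) by auto
  ultimately have "openin (Xtop \<L> A M) {x. (M, x, \<omega>) \<in> W}" for M \<omega>
    by (simp only:)
  then show "W \<subseteq> Yset \<L> \<MM> \<Omega> A \<and>
      (\<forall>M \<in> \<MM>. \<forall>\<omega> \<in> \<Omega> M. openin (Xtop \<L> A M) {x. (M, x, \<omega>) \<in> W})"
    using openin_subset[OF W] by (simp add: topspace_Ytop)
next
  assume W: "W \<subseteq> Yset \<L> \<MM> \<Omega> A \<and>
    (\<forall>M \<in> \<MM>. \<forall>\<omega> \<in> \<Omega> M. openin (Xtop \<L> A M) {x. (M, x, \<omega>) \<in> W})"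
  let ?\<U> = "{{M} \<times> {x. (M, x, \<omega>) \<in> W} \<times> {\<omega>} | M \<omega>. M \<in> \<MM> \<and> \<omega> \<in> \<Omega> M}"
  have "?\<U> \<subseteq> Ybase \<L> \<MM> \<Omega> A"
    using W unfolding Ybase_def by blast
  moreover have "\<Union>?\<U> = W"
  proof
    show "\<Union>?\<U> \<subseteq> W"
      by auto
    show "W \<subseteq> \<Union>?\<U>"
    proof
      fix p assume p: "p \<in> W"
      then obtain M x \<omega> where "p = (M, x, \<omega>)" "M \<in> \<MM>" "\<omega> \<in> \<Omega> M"
        using W by (auto simp: Yset_def)
      with p show "p \<in> \<Union>?\<U>"
        by blast
    qed
  qed
  ultimately show "openin (Ytop \<L> \<MM> \<Omega> A) W"
    unfolding openin_Ytop union_of_def arbitrary_def by blast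
qed

lemma openin_Ytop_sheet:
  assumes "M \<in> \<MM>" "\<omega> \<in> \<Omega> M" "openin (Xtop \<L> A M) V"
  shows "openin (Ytop \<L> \<MM> \<Omega> A) ({M} \<times> V \<times> {\<omega>})"
proof -
  have "{M} \<times> V \<times> {\<omega>} \<in> Ybase \<L> \<MM> \<Omega> A"
    using assms by (auto simp: Ybase_def)
  then show ?thesis
    by (simp add: openin_Ytop union_of_inc arbitrary_def)
qed

text \<open>Y is a union of finitely many sheets, each a continuous image of a compact
  hom-space.\<close>

lemma compact_space_Ytop:
  assumes "finite \<MM>" "is_alg (ari \<L>) A"
    and "\<And>M. M \<in> \<MM> \<Longrightarrow> finite (uni M)" "\<And>M. M \<in> \<MM> \<Longrightarrow> finite (\<Omega> M)"
  shows "compact_space (Ytop \<L> \<MM> \<Omega> A)"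
proof -
  have "compactin (Ytop \<L> \<MM> \<Omega> A) ((\<lambda>x. (M, x, \<omega>)) ` alg_hom (ari \<L>) A M)"
    if "M \<in> \<MM>" "\<omega> \<in> \<Omega> M" for M \<omega>
  proof (rule image_compactin)
    show "compactin (Xtop \<L> A M) (alg_hom (ari \<L>) A M)"
      using compact_space_Xtop[of \<L> A M] assms that by (simp add: compact_space_def topspace_Xtop)
    show "continuous_map (Xtop \<L> A M) (Ytop \<L> \<MM> \<Omega> A) (\<lambda>x. (M, x, \<omega>))"
      unfolding continuous_map_def
    proof (intro conjI allI impI)
      show "(\<lambda>x. (M, x, \<omega>)) \<in> topspace (Xtop \<L> A M) \<rightarrow> topspace (Ytop \<L> \<MM> \<Omega> A)"
        using that by (auto simp: topspace_Xtop topspace_Ytop Yset_def)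
      fix W assume "openin (Ytop \<L> \<MM> \<Omega> A) W"
      then have W: "openin (Xtop \<L> A M) {x. (M, x, \<omega>) \<in> W}"
        using that by (auto simp: openin_Ytop_iff)
      then have "{x \<in> topspace (Xtop \<L> A M). (M, x, \<omega>) \<in> W} = {x. (M, x, \<omega>) \<in> W}"
        using openin_subset by blast
      then show "openin (Xtop \<L> A M) {x \<in> topspace (Xtop \<L> A M). (M, x, \<omega>) \<in> W}"
        using W by simp
    qed
  qed
  then have "compactin (Ytop \<L> \<MM> \<Omega> A)
      (\<Union>((\<lambda>(M, \<omega>). (\<lambda>x. (M, x, \<omega>)) ` alg_hom (ari \<L>) A M) ` (SIGMA M:\<MM>. \<Omega> M)))"
    using assms by (intro compactin_Union finite_imageI finite_SigmaI) auto
  moreover have "(\<Union>((\<lambda>(M, \<omega>). (\<lambda>x. (M, x, \<omega>)) ` alg_hom (ari \<L>) A M) ` (SIGMA M:\<MM>. \<Omega> M)))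
      = topspace (Ytop \<L> \<MM> \<Omega> A)"
    by (auto simp: topspace_Ytop Yset_def)
  ultimately show ?thesis
    by (simp only: compact_space_def)
qed

text \<open>Points on different sheets are separated by the sheets themselves, so disjoint
  neighbourhoods in the hom-space are required only when the sheets coincide.\<close>

lemma Hausdorff_space_Ytop: "Hausdorff_space (Ytop \<L> \<MM> \<Omega> A)"
  unfolding Hausdorff_space_def topspace_Ytop
proof (intro allI impI)
  fix p q assume pq: "p \<in> Yset \<L> \<MM> \<Omega> A \<and> q \<in> Yset \<L> \<MM> \<Omega> A \<and> p \<noteq> q"
  obtain M x \<omega> M' x' \<omega>' where p: "p = (M, x, \<omega>)" and q: "q = (M', x', \<omega>')"
    by (metis prod.exhaust)
  note * = pq[unfolded p q]
  have x: "x \<in> topspace (Xtop \<L> A M)" "x' \<in> topspace (Xtop \<L> A M')"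
    using * by (auto simp: Yset_def topspace_Xtop)
  obtain V V' where V: "openin (Xtop \<L> A M) V" "openin (Xtop \<L> A M') V'" "x \<in> V" "x' \<in> V'"
    "M = M' \<Longrightarrow> \<omega> = \<omega>' \<Longrightarrow> disjnt V V'"
  proof (cases "M = M' \<and> \<omega> = \<omega>'")
    case True
    then show ?thesis
      using that x * Hausdorff_space_Xtop[of \<L> A M] unfolding Hausdorff_space_def by blast
  next
    case False
    then show ?thesis
      using that[of "topspace (Xtop \<L> A M)" "topspace (Xtop \<L> A M')"] x by auto
  qed
  have sheets: "openin (Ytop \<L> \<MM> \<Omega> A) ({M} \<times> V \<times> {\<omega>})"
      "openin (Ytop \<L> \<MM> \<Omega> A) ({M'} \<times> V' \<times> {\<omega>'})"
    using V * by (auto simp: Yset_def intro!: openin_Ytop_sheet)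
  have disj: "disjnt ({M} \<times> V \<times> {\<omega>}) ({M'} \<times> V' \<times> {\<omega>'})"
    using V(5) by (auto simp: disjnt_def)
  show "\<exists>U W. openin (Ytop \<L> \<MM> \<Omega> A) U \<and> openin (Ytop \<L> \<MM> \<Omega> A) W \<and>
      p \<in> U \<and> q \<in> W \<and> disjnt U W"
    by (rule exI[of _ "{M} \<times> V \<times> {\<omega>}"], rule exI[of _ "{M'} \<times> V' \<times> {\<omega>'}"],
        intro conjI sheets disj) (simp_all add: p q V(3,4))
qed

section \<open>Evaluation\<close>

text \<open>This is the map \<Phi>. It is restricted to \<open>uni A\<close> because the points of
  the dual space are extensional maps.\<close>

definition Yeval ::
    "('f, 'b) alg \<Rightarrow> ('f, 'a) alg \<times> ('b \<Rightarrow> 'a) \<times> ('a \<Rightarrow> bool) \<Rightarrow> 'b \<Rightarrow> bool" where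
  "Yeval A = (\<lambda>(M, x, \<omega>). \<lambda>a \<in> uni A. \<omega> (x a))"

lemma Yeval_in_dual:
  assumes "is_lang \<L>" "is_alg (ari \<L>) A"
    and "\<And>M. M \<in> \<MM> \<Longrightarrow> \<Omega> M \<subseteq> bdl_hom (reduct \<L> M) two"
    and "p \<in> Yset \<L> \<MM> \<Omega> A"
  shows "Yeval A p \<in> bdl_hom (reduct \<L> A) two"
proof -
  obtain M x \<omega> where p: "p = (M, x, \<omega>)" "M \<in> \<MM>" "x \<in> alg_hom (ari \<L>) A M" "\<omega> \<in> \<Omega> M"
    using assms(4) by (auto simp: Yset_def)
  have "\<omega> \<in> bdl_hom (reduct \<L> M) two"
    using p assms(3) by blast
  moreover have "x \<in> bdl_hom (reduct \<L> A) (reduct \<L> M)"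
    using alg_hom_imp_bdl_hom assms(1,2) p(3) by blast
  moreover have "x a \<in> uni M" if "a \<in> uni A" for a
    using p(3) that by (auto simp: alg_hom_def)
  ultimately show ?thesis
    using reduct_closed[OF assms(1,2)]
    by (auto simp: bdl_hom_two_iff[of _ "reduct \<L> A"] bdl_hom_two_iff[of _ "reduct \<L> M"]
        p(1) Yeval_def bdl_hom_def[of "reduct \<L> A" "reduct \<L> M"])
qed

section \<open>The relation on Y as pointwise order of evaluations\<close>

lemma subuniverse_image_pair:
  assumes "is_alg ar A" "x \<in> alg_hom ar A M" "y \<in> alg_hom ar A N"
  shows "subuniverse ar (prod_alg M N) ((\<lambda>a. (x a, y a)) ` uni A)"
proof -
  have "opr (prod_alg M N) f ps \<in> (\<lambda>a. (x a, y a)) ` uni A"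
    if "ps \<in> args ar f ((\<lambda>a. (x a, y a)) ` uni A)" for f ps
  proof -
    \<comment> \<open>Preimages are chosen for the pairs rather than for each coordinate separately,
      so a single list \<open>as\<close> serves both \<open>x\<close> and \<open>y\<close>.\<close>
    have "ps \<in> map (\<lambda>a. (x a, y a)) ` lists (uni A)"
      using that by (auto simp: args_def lists_image[symmetric])
    then obtain as where as: "ps = map (\<lambda>a. (x a, y a)) as" "set as \<subseteq> uni A"
      by auto
    have args: "as \<in> args ar f (uni A)"
      using that as by (auto simp: args_def)
    have "opr (prod_alg M N) f ps = (x (opr A f as), y (opr A f as))"
      using assms(2,3) args by (simp add: prod_alg_def alg_hom_def as(1) comp_def)
    moreover have "opr A f as \<in> uni A"
      using assms(1) args by (auto simp: is_alg_def)
    ultimately show ?thesis by blast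
  qed
  then show ?thesis
    using assms by (auto simp: subuniverse_def is_alg_def prod_alg_def alg_hom_def)
qed

text \<open>All candidates lie in the power set of a finite product, and in a finite family every
  member is below a maximal one.\<close>

lemma Rmax_extends:
  assumes "finite (uni M)" "finite (uni N)"
    and "subuniverse (ari \<L>) (prod_alg M N) s" "s \<subseteq> below M \<omega> N \<omega>'"
  obtains r where "r \<in> Rmax \<L> M \<omega> N \<omega>'" "s \<subseteq> r"
proof -
  let ?C = "{s. subuniverse (ari \<L>) (prod_alg M N) s \<and> s \<subseteq> below M \<omega> N \<omega>'}"
  have "?C \<subseteq> Pow (uni M \<times> uni N)"
    by (auto simp: subuniverse_def prod_alg_def)
  then have "finite ?C"
    by (rule finite_subset) (use assms(1,2) in simp)
  then obtain r where "r \<in> ?C" "s \<subseteq> r" "\<forall>t \<in> ?C. r \<subseteq> t \<longrightarrow> r = t"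
    using finite_has_maximal2[of ?C s] assms(3,4) by blast
  then show ?thesis
    by (intro that[of r]) (auto simp: Rmax_def)
qed

text \<open>The evaluations are pointwise ordered exactly when all pairs \<open>(x a, y a)\<close>
  lie in \<open>below\<close>. These pairs form a subuniverse, which then extends to a maximal one;
  conversely, members of \<open>Rmax\<close> lie in \<open>below\<close>. From here on, maximal
  relations can be replaced by evaluations.\<close>

lemma Yord_iff:
  assumes "is_alg (ari \<L>) A" "\<And>M. M \<in> \<MM> \<Longrightarrow> finite (uni M)"
    and p: "p \<in> Yset \<L> \<MM> \<Omega> A" and q: "q \<in> Yset \<L> \<MM> \<Omega> A"
  shows "(p, q) \<in> Yord \<L> \<MM> \<Omega> A \<longleftrightarrow> (\<forall>a \<in> uni A. Yeval A p a \<le> Yeval A q a)"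
proof -
  obtain M x \<omega> where p': "p = (M, x, \<omega>)" "M \<in> \<MM>" "x \<in> alg_hom (ari \<L>) A M" "\<omega> \<in> \<Omega> M"
    using p by (auto simp: Yset_def)
  obtain N y \<omega>' where q': "q = (N, y, \<omega>')" "N \<in> \<MM>" "y \<in> alg_hom (ari \<L>) A N" "\<omega>' \<in> \<Omega> N"
    using q by (auto simp: Yset_def)
  show ?thesis
  proof
    assume "(p, q) \<in> Yord \<L> \<MM> \<Omega> A"
    then obtain r where "r \<in> Rmax \<L> M \<omega> N \<omega>'" "\<forall>a \<in> uni A. (x a, y a) \<in> r"
      by (auto simp: Yord_def p'(1) q'(1))
    then have "\<forall>a \<in> uni A. (x a, y a) \<in> below M \<omega> N \<omega>'"
      by (auto simp: Rmax_def)
    then show "\<forall>a \<in> uni A. Yeval A p a \<le> Yeval A q a"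
      by (auto simp: Yeval_def p'(1) q'(1) below_def)
  next
    assume le: "\<forall>a \<in> uni A. Yeval A p a \<le> Yeval A q a"
    have "(\<lambda>a. (x a, y a)) ` uni A \<subseteq> below M \<omega> N \<omega>'"
      using le p'(3) q'(3) by (auto simp: Yeval_def p'(1) q'(1) below_def alg_hom_def)
    then obtain r where "r \<in> Rmax \<L> M \<omega> N \<omega>'" "(\<lambda>a. (x a, y a)) ` uni A \<subseteq> r"
      by (rule Rmax_extends[OF assms(2)[OF p'(2)] assms(2)[OF q'(2)]
            subuniverse_image_pair[OF assms(1) p'(3) q'(3)]])
    then show "(p, q) \<in> Yord \<L> \<MM> \<Omega> A"
      using p q by (auto simp: Yord_def p'(1) q'(1))
  qed
qed

text \<open>Continuity into a subspace of a power is checked at each \<open>a\<close> separately. On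
  a single sheet the value at \<open>a\<close> depends on \<open>x\<close> only through
  \<open>x a\<close>, a projection to a discrete space.\<close>

lemma continuous_map_Yeval:
  fixes \<MM> :: "('f, 'a) alg set" and A :: "('f, 'b) alg"
  assumes "is_lang \<L>" "is_alg (ari \<L>) A"
    and "\<And>M. M \<in> \<MM> \<Longrightarrow> \<Omega> M \<subseteq> bdl_hom (reduct \<L> M) two"
  shows "continuous_map (Ytop \<L> \<MM> \<Omega> A) (dual_top (reduct \<L> A)) (Yeval A)"
  unfolding dual_top_def continuous_map_in_subtopology continuous_map_componentwise lcar_reduct
proof (intro conjI ballI)
  show "Yeval A ` topspace (Ytop \<L> \<MM> \<Omega> A) \<subseteq> extensional (uni A)"
    by (auto simp: Yeval_def)
  show "Yeval A \<in> topspace (Ytop \<L> \<MM> \<Omega> A) \<rightarrow> bdl_hom (reduct \<L> A) two"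
    using Yeval_in_dual[OF assms] by (auto simp: topspace_Ytop)
  fix a assume a: "a \<in> uni A"
  have "openin (Xtop \<L> A M) {x \<in> alg_hom (ari \<L>) A M. \<omega> (x a) \<in> B}"
    for M :: "('f, 'a) alg" and \<omega> :: "'a \<Rightarrow> bool" and B
  proof -
    have "continuous_map (Xtop \<L> A M) (discrete_topology (uni M)) (\<lambda>x. x a)"
      unfolding Xtop_def
      by (rule continuous_map_from_subtopology) (use a in \<open>rule continuous_map_product_projection\<close>)
    moreover have "openin (discrete_topology (uni M)) {c \<in> uni M. \<omega> c \<in> B}"
      by auto
    ultimately have "openin (Xtop \<L> A M) {x \<in> topspace (Xtop \<L> A M). x a \<in> {c \<in> uni M. \<omega> c \<in> B}}"
      by (rule openin_continuous_map_preimage)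
    moreover have "{x \<in> topspace (Xtop \<L> A M). x a \<in> {c \<in> uni M. \<omega> c \<in> B}}
        = {x \<in> alg_hom (ari \<L>) A M. \<omega> (x a) \<in> B}"
      using a by (auto simp: topspace_Xtop alg_hom_def)
    ultimately show ?thesis by simp
  qed
  moreover have "{x. (M, x, \<omega>) \<in> {p \<in> Yset \<L> \<MM> \<Omega> A. Yeval A p a \<in> B}}
      = {x \<in> alg_hom (ari \<L>) A M. \<omega> (x a) \<in> B}" if "M \<in> \<MM>" "\<omega> \<in> \<Omega> M" for M \<omega> B
    using a that by (auto simp: Yset_def Yeval_def)
  ultimately have "openin (Ytop \<L> \<MM> \<Omega> A) {p \<in> Yset \<L> \<MM> \<Omega> A. Yeval A p a \<in> B}" for B
    unfolding openin_Ytop_iff by simp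
  then show "continuous_map (Ytop \<L> \<MM> \<Omega> A) (discrete_topology UNIV) (\<lambda>p. Yeval A p a)"
    by (simp add: continuous_map_def topspace_Ytop)
qed

section \<open>Separation and surjectivity of evaluation\<close>

lemma Yeval_separates:
  assumes "Sep \<L> \<MM> \<Omega>" "A \<in> ISP TYPE('i) (ari \<L>) \<MM>" "a \<in> uni A" "b \<in> uni A" "a \<noteq> b"
  obtains p where "p \<in> Yset \<L> \<MM> \<Omega> A" "Yeval A p a \<noteq> Yeval A p b"
proof -
  obtain M h where h: "M \<in> \<MM>" "h \<in> alg_hom (ari \<L>) A M" "h a \<noteq> h b"
    using ISP_separates[OF assms(2-)] by blast
  have "h a \<in> uni M" "h b \<in> uni M"
    using h(2) assms(3,4) by (auto simp: alg_hom_def)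
  \<comment> \<open>\<open>h\<close> keeps the elements apart in \<open>M\<close>, and (Sep) then
    separates their images; the point of Y sought is the composite of \<open>h\<close> and
    \<open>u\<close> paired with \<open>\<omega>\<close>.\<close>
  then obtain M' u \<omega> where u: "M' \<in> \<MM>" "u \<in> alg_hom (ari \<L>) M M'" "\<omega> \<in> \<Omega> M'"
      "\<omega> (u (h a)) \<noteq> \<omega> (u (h b))"
    using assms(1) h(1,3) unfolding Sep_def by blast
  let ?x = "\<lambda>a \<in> uni A. u (h a)"
  have "?x \<in> alg_hom (ari \<L>) A M'"
    using alg_hom_compose h(2) u(2) assms(2) by (fastforce simp: ISP_def)
  then have "(M', ?x, \<omega>) \<in> Yset \<L> \<MM> \<Omega> A"
    using u by (auto simp: Yset_def)
  moreover have "Yeval A (M', ?x, \<omega>) a \<noteq> Yeval A (M', ?x, \<omega>) b"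
    using u(4) assms(3,4) by (simp add: Yeval_def)
  ultimately show ?thesis
    using that by blast
qed

text \<open>Prescribing finitely many values of \<open>h\<close> amounts to prescribing them at the meet \<open>a\<close> of the arguments
  sent to \<open>1\<close> and the join \<open>b\<close> of those sent to \<open>0\<close>.\<close>

lemma bdl_hom_two_finite_values:
  assumes L: "lzero L \<in> lcar L" "lone L \<in> lcar L"
      "\<And>x y. x \<in> lcar L \<Longrightarrow> y \<in> lcar L \<Longrightarrow> lmeet L x y \<in> lcar L"
      "\<And>x y. x \<in> lcar L \<Longrightarrow> y \<in> lcar L \<Longrightarrow> ljoin L x y \<in> lcar L"
    and h: "h \<in> bdl_hom L two"
    and "finite K" "K \<subseteq> lcar L"
  shows "\<exists>a \<in> lcar L. \<exists>b \<in> lcar L. h a \<and> \<not> h b \<and>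
    (\<forall>g \<in> bdl_hom L two. g a \<and> \<not> g b \<longrightarrow> (\<forall>k \<in> K. g k = h k))"
  using assms(6,7)
proof (induction rule: finite_induct)
  case empty
  \<comment> \<open>With no values prescribed, \<open>lone L\<close> and \<open>lzero L\<close>
    serve as \<open>a\<close> and \<open>b\<close>.\<close>
  then show ?case
    using L h by (auto simp: bdl_hom_two_iff)
next
  case (insert k K)
  then obtain a b where ab: "a \<in> lcar L" "b \<in> lcar L" "h a" "\<not> h b"
      "\<forall>g \<in> bdl_hom L two. g a \<and> \<not> g b \<longrightarrow> (\<forall>k \<in> K. g k = h k)"
    by auto
  have k: "k \<in> lcar L"
    using insert by simp
  show ?case
  proof (cases "h k")
    case True
    \<comment> \<open>A new argument sent to 1 is absorbed by replacing \<open>a\<close> with its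
      meet with \<open>k\<close>; \<open>b\<close> is kept. The other case is dual.\<close>
    have "g j = h j" if g: "g \<in> bdl_hom L two" "g (lmeet L a k)" "\<not> g b" and j: "j \<in> insert k K" for g j
    proof -
      have "g a" "g k"
        using g(1,2) ab(1) k by (simp_all add: bdl_hom_two_iff)
      then show ?thesis
        using ab(5) g j True by blast
    qed
    moreover have "h (lmeet L a k)"
      using ab(1,3) k True h by (simp add: bdl_hom_two_iff)
    ultimately show ?thesis
      using ab(2,4) L(3)[OF ab(1) k] by blast
  next
    case False
    have "g j = h j" if g: "g \<in> bdl_hom L two" "g a" "\<not> g (ljoin L b k)" and j: "j \<in> insert k K" for g j
    proof -
      have "\<not> g b" "\<not> g k"
        using g(1,3) ab(2) k by (simp_all add: bdl_hom_two_iff)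
      then show ?thesis
        using ab(5) g j False by blast
    qed
    moreover have "\<not> h (ljoin L b k)"
      using ab(2,4) k False h by (simp add: bdl_hom_two_iff)
    ultimately show ?thesis
      using ab(1,3) L(4)[OF ab(2) k] by blast
  qed
qed

lemma Yeval_surj:
  assumes lang: "is_lang \<L>"
    and \<Omega>: "\<And>M. M \<in> \<MM> \<Longrightarrow> \<Omega> M \<subseteq> bdl_hom (reduct \<L> M) two"
    and "Sep \<L> \<MM> \<Omega>" "A \<in> ISP TYPE('i) (ari \<L>) \<MM>"
    and cpt: "compact_space (Ytop \<L> \<MM> \<Omega> A)"
  shows "Yeval A ` Yset \<L> \<MM> \<Omega> A = bdl_hom (reduct \<L> A) two"
proof
  have A: "is_alg (ari \<L>) A"
    using assms(4) by (simp add: ISP_def)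
  note cl = reduct_closed[OF lang A]
  show "Yeval A ` Yset \<L> \<MM> \<Omega> A \<subseteq> bdl_hom (reduct \<L> A) two"
    using Yeval_in_dual[OF lang A \<Omega>] by blast
  show "bdl_hom (reduct \<L> A) two \<subseteq> Yeval A ` Yset \<L> \<MM> \<Omega> A"
  proof
    fix h assume h: "h \<in> bdl_hom (reduct \<L> A) two"
    \<comment> \<open>A point common to all \<open>C a\<close> is a preimage of \<open>h\<close>;
      such a point is found by the finite intersection property.\<close>
    define C where "C = (\<lambda>a. {p \<in> Yset \<L> \<MM> \<Omega> A. Yeval A p a = h a})"
    have finite_case: "\<exists>p \<in> Yset \<L> \<MM> \<Omega> A. \<forall>k \<in> K. Yeval A p k = h k"
      if K: "finite K" "K \<subseteq> uni A" for K
    proof -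
      obtain a b where ab: "a \<in> uni A" "b \<in> uni A" "h a" "\<not> h b"
          "\<forall>g \<in> bdl_hom (reduct \<L> A) two. g a \<and> \<not> g b \<longrightarrow> (\<forall>k \<in> K. g k = h k)"
        using bdl_hom_two_finite_values[of "reduct \<L> A" h K] cl h K by auto
      \<comment> \<open>As \<open>h\<close> is true at \<open>a\<close> but false at
        \<open>?c\<close>, the two differ and some \<open>p\<close> separates them. The value of
        \<open>Yeval A p\<close> at \<open>?c\<close> is the conjunction of its values at
        \<open>a\<close> and \<open>b\<close>, so a difference from the value at \<open>a\<close>
        forces true at \<open>a\<close> and false at \<open>b\<close>.\<close>
      let ?c = "lmeet (reduct \<L> A) a b"
      have "?c \<in> uni A" "\<not> h ?c"
        using ab cl h by (auto simp: bdl_hom_two_iff)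
      then obtain p where p: "p \<in> Yset \<L> \<MM> \<Omega> A" "Yeval A p a \<noteq> Yeval A p ?c"
        using Yeval_separates[OF assms(3,4) ab(1)] ab(3) by metis
      have g: "Yeval A p \<in> bdl_hom (reduct \<L> A) two"
        using Yeval_in_dual[OF lang A \<Omega> p(1)] .
      then have "Yeval A p a \<and> \<not> Yeval A p b"
        using p(2) ab(1,2) by (auto simp: bdl_hom_two_iff)
      then show ?thesis
        using ab(5) g p(1) by blast
    qed
    have "closedin (Ytop \<L> \<MM> \<Omega> A) (C a)" if "a \<in> uni A" for a
    proof -
      have "continuous_map (Ytop \<L> \<MM> \<Omega> A) (discrete_topology UNIV) ((\<lambda>g. g a) \<circ> Yeval A)"
        using continuous_map_compose[OF continuous_map_Yeval[OF lang A \<Omega>] continuous_map_dual_eval] that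
        by simp
      then have "closedin (Ytop \<L> \<MM> \<Omega> A)
          {p \<in> topspace (Ytop \<L> \<MM> \<Omega> A). ((\<lambda>g. g a) \<circ> Yeval A) p \<in> {h a}}"
        by (rule closedin_continuous_map_preimage) simp
      then show ?thesis
        by (simp add: C_def topspace_Ytop)
    qed
    moreover have "\<Inter>\<F> \<noteq> {}" if \<F>: "finite \<F>" "\<F> \<subseteq> C ` uni A" for \<F>
    proof -
      obtain K where K: "K \<subseteq> uni A" "finite K" "\<F> = C ` K"
        using finite_subset_image[OF \<F>] by blast
      then obtain p where "p \<in> Yset \<L> \<MM> \<Omega> A" "\<And>k. k \<in> K \<Longrightarrow> Yeval A p k = h k"
        using finite_case[of K] by blast
      then have "p \<in> \<Inter>\<F>"
        by (simp add: K(3) C_def)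
      then show ?thesis
        by blast
    qed
    ultimately have "\<Inter>(C ` uni A) \<noteq> {}"
      by (intro cpt[unfolded compact_space_fip, rule_format, of "C ` uni A"]) auto
    then obtain p where p: "\<And>a. a \<in> uni A \<Longrightarrow> p \<in> C a"
      by blast
    \<comment> \<open>The lattice zero, supplied by \<open>cl(1)\<close>, shows that
      \<open>uni A\<close> is nonempty, so \<open>p\<close> lies in at least one \<open>C a\<close>
      and hence in Y.\<close>
    then have "p \<in> Yset \<L> \<MM> \<Omega> A" "\<And>a. a \<in> uni A \<Longrightarrow> Yeval A p a = h a"
      using cl(1) by (auto simp: C_def)
    moreover have "Yeval A p \<in> extensional (uni A)" "h \<in> extensional (uni A)"
      using h by (auto simp: Yeval_def bdl_hom_two_iff split: prod.split)
    ultimately have "Yeval A p = h"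
      by (intro extensionalityI) auto
    then show "h \<in> Yeval A ` Yset \<L> \<MM> \<Omega> A"
      using \<open>p \<in> Yset \<L> \<MM> \<Omega> A\<close> by blast
  qed
qed

section \<open>The quotient\<close>

text \<open>The relation \<open>r \<inter> r\<inverse>\<close> is the kernel of \<open>f\<close>, so
  \<open>f\<close> factors through a continuous bijection from a compact quotient to a Hausdorff
  space, which is a homeomorphism.\<close>

lemma quotient_priestley_iso:
  fixes f :: "'a \<Rightarrow> 'b"
  assumes cont: "continuous_map T T' f" and cpt: "compact_space T" and haus: "Hausdorff_space T'"
    and surj: "f ` topspace T = topspace T'"
    and po: "partial_order_on (topspace T') r'"
    and r: "r \<subseteq> topspace T \<times> topspace T"
    and ord: "\<And>x y. x \<in> topspace T \<Longrightarrow> y \<in> topspace T \<Longrightarrow> (x, y) \<in> r \<longleftrightarrow> (f x, f y) \<in> r'"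
  shows "priestley_iso (quotient_top T (r \<inter> r\<inverse>)) (quotient_ord (topspace T) (r \<inter> r\<inverse>) r) T' r'"
proof -
  define e where "e = r \<inter> r\<inverse>"
  \<comment> \<open>Antisymmetry of \<open>r'\<close> turns mutual comparability into equality of
    images; reflexivity gives the converse.\<close>
  have e: "(x, y) \<in> e \<longleftrightarrow> x \<in> topspace T \<and> y \<in> topspace T \<and> f x = f y" for x y
  proof -
    have "(f x, f y) \<in> r' \<and> (f y, f x) \<in> r' \<longleftrightarrow> f x = f y" if "x \<in> topspace T" "y \<in> topspace T"
    proof -
      have "f x \<in> topspace T'"
        using that surj by blast
      then show ?thesis
        using partial_order_onD(1,3)[OF po] by (metis antisymD refl_onD)
    qed
    then show ?thesis
      using r ord by (auto simp: e_def)
  qed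
  \<comment> \<open>The choice of representative is harmless because \<open>f\<close> is constant on
    classes.\<close>
  define g where "g = (\<lambda>C. f (SOME x. x \<in> C))"
  have cls: "e `` {x} = {y \<in> topspace T. f y = f x}" if "x \<in> topspace T" for x
    using e that by auto
  have g: "g (e `` {x}) = f x" if "x \<in> topspace T" for x
  proof -
    have "\<exists>y. y \<in> e `` {x}"
      using cls that by auto
    then have "(SOME y. y \<in> e `` {x}) \<in> e `` {x}"
      by (rule someI_ex)
    then show ?thesis
      using cls that by (auto simp: g_def)
  qed
  have Q: "topspace (quotient_top T e) = (\<lambda>x. e `` {x}) ` topspace T"
    by (auto simp: topspace_quotient_top quotient_def)
  note qm = quotient_map_quotient_top[of T e]
  have "continuous_map T T' (g \<circ> (\<lambda>x. e `` {x}))"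
    by (rule continuous_map_eq[OF cont]) (simp add: g)
  then have "continuous_map (quotient_top T e) T' g"
    using continuous_compose_quotient_map[OF qm] by blast
  moreover have "compact_space (quotient_top T e)"
    using image_compactin[OF cpt[unfolded compact_space_def] quotient_imp_continuous_map[OF qm]]
    by (simp only: compact_space_def Q)
  moreover have "g ` topspace (quotient_top T e) = topspace T'"
    unfolding Q image_image surj[symmetric] by (rule image_cong) (simp_all add: g)
  moreover have "inj_on g (topspace (quotient_top T e))"
  proof (rule inj_onI)
    fix C D
    assume CD: "C \<in> topspace (quotient_top T e)" "D \<in> topspace (quotient_top T e)" "g C = g D"
    then obtain x y where xy: "x \<in> topspace T" "C = e `` {x}" "y \<in> topspace T" "D = e `` {y}"
      by (auto simp: Q)
    then have "f x = f y"
      using CD(3) by (simp add: g)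
    then show "C = D"
      by (simp add: xy cls)
  qed
  ultimately have "homeomorphic_map (quotient_top T e) T' g"
    using haus continuous_imp_homeomorphic_map by blast
  moreover have "(C, D) \<in> quotient_ord (topspace T) e r \<longleftrightarrow> (g C, g D) \<in> r'"
    if CD: "C \<in> topspace (quotient_top T e)" "D \<in> topspace (quotient_top T e)" for C D
  proof -
    obtain x y where xy: "x \<in> topspace T" "C = e `` {x}" "y \<in> topspace T" "D = e `` {y}"
      using CD by (auto simp: Q)
    have "(C, D) \<in> quotient_ord (topspace T) e r \<longleftrightarrow> (\<exists>x' \<in> C. \<exists>y' \<in> D. (x', y') \<in> r)"
      using CD by (auto simp: quotient_ord_def topspace_quotient_top)
    \<comment> \<open>\<open>quotient_ord\<close> asks only for some related representatives; since
      \<open>r\<close> depends only on values of \<open>f\<close>, any representatives decide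
      it.\<close>
    also have "\<dots> \<longleftrightarrow> (f x, f y) \<in> r'"
    proof
      assume "\<exists>x' \<in> C. \<exists>y' \<in> D. (x', y') \<in> r"
      then obtain x' y' where "x' \<in> C" "y' \<in> D" "(x', y') \<in> r"
        by blast
      then show "(f x, f y) \<in> r'"
        using ord[of x' y'] by (simp add: xy cls)
    next
      assume "(f x, f y) \<in> r'"
      then have "(x, y) \<in> r"
        using ord[of x y] xy by simp
      moreover have "x \<in> C" "y \<in> D"
        by (simp_all only: xy cls) (simp_all add: xy)
      ultimately show "\<exists>x' \<in> C. \<exists>y' \<in> D. (x', y') \<in> r"
        by blast
    qed
    finally show ?thesis
      using xy g by simp
  qed
  ultimately show ?thesis
    unfolding priestley_iso_def e_def by blast
qed

theorem theorem2p3: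
  fixes \<L> :: "'f lang"
    and \<MM> :: "('f, 'a) alg set"
    and \<Omega> :: "('f, 'a) alg \<Rightarrow> ('a \<Rightarrow> bool) set"
    and A :: "('f, 'b) alg"
  assumes "is_lang \<L>"
    and "finite \<MM>"
    and "\<And>M. M \<in> \<MM> \<Longrightarrow> D_based \<L> M"
    and "\<And>M. M \<in> \<MM> \<Longrightarrow> finite (uni M)"
    and "\<And>M. M \<in> \<MM> \<Longrightarrow> \<Omega> M \<subseteq> bdl_hom (reduct \<L> M) two"
    and "Sep \<L> \<MM> \<Omega>"
    and "A \<in> ISP TYPE('i) (ari \<L>) \<MM>"
  shows "compact_space (Ytop \<L> \<MM> \<Omega> A) \<and> Hausdorff_space (Ytop \<L> \<MM> \<Omega> A)
         \<and> preorder_on (Yset \<L> \<MM> \<Omega> A) (Yord \<L> \<MM> \<Omega> A)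
         \<and> priestley_space
           (quotient_top (Ytop \<L> \<MM> \<Omega> A) (Yequiv \<L> \<MM> \<Omega> A))
           (quotient_ord (Yset \<L> \<MM> \<Omega> A) (Yequiv \<L> \<MM> \<Omega> A) (Yord \<L> \<MM> \<Omega> A))
         \<and> priestley_iso
           (quotient_top (Ytop \<L> \<MM> \<Omega> A) (Yequiv \<L> \<MM> \<Omega> A))
           (quotient_ord (Yset \<L> \<MM> \<Omega> A) (Yequiv \<L> \<MM> \<Omega> A) (Yord \<L> \<MM> \<Omega> A))
           (dual_top (reduct \<L> A))
           (dual_ord (reduct \<L> A))"
proof -
  have A: "is_alg (ari \<L>) A"
    using assms(7) by (simp add: ISP_def)
  have fin\<Omega>: "finite (\<Omega> M)" if "M \<in> \<MM>" for M
  proof (rule finite_subset)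
    \<comment> \<open>Extensionality places \<Omega> M inside a finite function space, so Y has
      finitely many sheets.\<close>
    show "\<Omega> M \<subseteq> uni M \<rightarrow>\<^sub>E (UNIV :: bool set)"
      using assms(5)[OF that] by (fastforce simp: bdl_hom_def two_def)
    show "finite (uni M \<rightarrow>\<^sub>E (UNIV :: bool set))"
      using assms(4)[OF that] by (intro finite_PiE) auto
  qed
  let ?T = "Ytop \<L> \<MM> \<Omega> A" and ?D = "dual_top (reduct \<L> A)" and ?r = "Yord \<L> \<MM> \<Omega> A"
    and ?r' = "dual_ord (reduct \<L> A)"
  have cpt: "compact_space ?T"
    by (intro compact_space_Ytop assms(2,4) A fin\<Omega>)
  have surj: "Yeval A ` topspace ?T = topspace ?D"
    unfolding topspace_Ytop topspace_dual_top
    by (intro Yeval_surj[OF assms(1) _ assms(6,7) cpt] assms(5))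
  have cont: "continuous_map ?T ?D (Yeval A)"
    by (intro continuous_map_Yeval assms(1,5) A)
  \<comment> \<open>The dual space is the continuous image of the compact space Y.\<close>
  have "compact_space ?D"
    using image_compactin[OF _ cont, of "topspace ?T"] cpt surj by (simp add: compact_space_def)
  then have pries: "priestley_space ?D ?r'"
    by (rule priestley_space_dual)
  then have po: "partial_order_on (topspace ?D) ?r'"
    by (simp add: priestley_space_def)
  have r: "?r \<subseteq> topspace ?T \<times> topspace ?T"
    by (auto simp: Yord_def topspace_Ytop)
  have ord: "(p, q) \<in> ?r \<longleftrightarrow> (Yeval A p, Yeval A q) \<in> ?r'"
    if "p \<in> topspace ?T" "q \<in> topspace ?T" for p q
    using that Yord_iff[OF A assms(4)] Yeval_in_dual[OF assms(1) A assms(5)]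
    by (simp add: topspace_Ytop dual_ord_def)
  let ?Q = "quotient_top ?T (Yequiv \<L> \<MM> \<Omega> A)"
    and ?s = "quotient_ord (Yset \<L> \<MM> \<Omega> A) (Yequiv \<L> \<MM> \<Omega> A) ?r"
  have iso: "priestley_iso ?Q ?s ?D ?r'"
    using quotient_priestley_iso[OF cont cpt Hausdorff_space_dual_top surj po r ord]
    by (simp add: Yequiv_def topspace_Ytop)
  have "?s \<subseteq> topspace ?Q \<times> topspace ?Q"
    by (auto simp: quotient_ord_def topspace_quotient_top topspace_Ytop)
  \<comment> \<open>The Priestley properties of the quotient are carried back from the dual space
    along the isomorphism.\<close>
  with iso have "priestley_space ?Q ?s"
    using priestley_space_iso[OF _ _ _ pries] unfolding priestley_iso_def by blast
  moreover have "preorder_on (Yset \<L> \<MM> \<Omega> A) ?r"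
    using preorder_on_pullback[OF r po _ ord] surj by (simp add: topspace_Ytop)
  ultimately show ?thesis
    using cpt iso Hausdorff_space_Ytop by blast
qed

end
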